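(* Let $\beta>0$, $0<c_1,c_2<1$, $c_1\ne c_2$, and let $n_1,n_2\ge1$ be integers. Let $M^{(1)}_{(n_1,n_2)},M^{(2)}_{(n_1,n_2)}$ be the Meixner I multiple orthogonal polynomials of type I (for the weights $\omega_a(k)=\frac{\Gamma(\beta+k)c_a^k}{\Gamma(\beta)\Gamma(k+1)}$, $k\in\mathbb N_0$, $a\in\{1,2\}$) biorthogonal to the monic Meixner I polynomials of type II. Then, for $a\in\{1,2\}$, $$M^{(a)}_{(n_1,n_2)}(x)=K_a\;F^{2:1;0}_{1:1;0}\left[{(-n_a+1,\beta):(-x);--\atop(-n_1-n_2+2):(\beta);--}\Bigg|\frac{(c_a-\hat c_a)(1-c_a)}{c_a(1-\hat c_a)},\frac{c_a-\hat c_a}{1-\hat c_a}\right]$$ $$=K_a\sum_{l=0}^{n_a-1}\sum_{m=0}^{n_a-1-l}\frac{(-n_a+1)_{l+m}\,(\beta)_{l+m}}{l!\,m!\,(-n_1-n_2+2)_{l+m}\,(\beta)_l}\left(\frac{(c_a-\hat c_a)(1-c_a)}{c_a(1-\hat c_a)}\right)^l\left(\frac{c_a-\hat c_a}{1-\hat c_a}\right)^m(-x)_l,$$ where $$K_a=\frac{(-1)^{n_a-1}(n_1+n_2-2)!\,(1-c_a)^{n_1+n_2-1+\beta}}{(n_1-1)!\,(n_2-1)!\,(\beta)_{n_1+n_2-1}}\left(\frac{1-\hat c_a}{c_a-\hat c_a}\right)^{n_1+n_2-1}.$$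
   Context: Pochhammer symbol: $(x)_0=1$, $(x)_n=x(x+1)\cdots(x+n-1)$. Notation: $\hat c_1=c_2$, $\hat c_2=c_1$. The type II polynomial $M_{(m_1,m_2)}$, $m_1,m_2\ge0$, is the unique monic polynomial of degree $m_1+m_2$ with $\sum_{k=0}^\infty(-k)_jM_{(m_1,m_2)}(k)\,\omega_a(k)=0$ for $j\in\{0,\dots,m_a-1\}$, $a\in\{1,2\}$. The type I polynomials biorthogonal to them are the unique pair with $\deg M^{(a)}_{(n_1,n_2)}\le n_a-1$ such that $$\sum_{k=0}^\infty k^j\big(M^{(1)}_{(n_1,n_2)}(k)\omega_1(k)+M^{(2)}_{(n_1,n_2)}(k)\omega_2(k)\big)=0,\quad j\in\{0,\dots,n_1+n_2-2\},$$ and $$\sum_{k=0}^\infty M_{(m_1,m_2)}(k)\big(M^{(1)}_{(n_1,n_2)}(k)\omega_1(k)+M^{(2)}_{(n_1,n_2)}(k)\omega_2(k)\big)=1\quad\text{whenever }m_1+m_2=n_1+n_2-1$$ (equivalently, since $M_{(m_1,m_2)}$ is monic, the sum with $k^{n_1+n_2-1}$ in place of $M_{(m_1,m_2)}(k)$ equals $1$). Kampé de Fériet series: $$F^{p:r;s}_{q:n;t}\left[{(a_i):(b_i);(d_i)\atop(\alpha_i):(\beta_i);(\gamma_i)}\Bigg|x,y\right]=\sum_{l,m\ge0}\frac{\prod_i(a_i)_{l+m}}{\prod_i(\alpha_i)_{l+m}}\frac{\prod_i(b_i)_l}{\prod_i(\beta_i)_l}\frac{\prod_i(d_i)_m}{\prod_i(\gamma_i)_m}\frac{x^l}{l!}\frac{y^m}{m!},$$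 "$--$" denoting an empty list; here the parameter $-n_a+1$ makes the sum finite, over $l+m\le n_a-1$. *)

theory Defs
  imports "HOL-Analysis.Analysis"
begin

text \<open>
  Families with the two indices 1 and 2 (the parameters \<open>c\<close>, the multi-indices, the type I
  polynomials) are functions on the two-element type \<open>2\<close>. There the literals \<open>1\<close> and \<open>2\<close>
  denote its two distinct elements (with \<open>2 = 0\<close>).
\<close>

definition hat :: "2 \<Rightarrow> 2" where
  "hat a = (if a = 1 then 2 else 1)"

definition meixnerI_weight :: "real \<Rightarrow> (2 \<Rightarrow> real) \<Rightarrow> 2 \<Rightarrow> nat \<Rightarrow> real" where
  "meixnerI_weight \<beta> c a k = Gamma (\<beta> + real k) * c a ^ k / (Gamma \<beta> * Gamma (real k + 1))"

definition is_meixnerI_type_II :: "real \<Rightarrow> (2 \<Rightarrow> real) \<Rightarrow> (2 \<Rightarrow> nat) \<Rightarrow> real poly \<Rightarrow> bool" where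
  "is_meixnerI_type_II \<beta> c m P \<longleftrightarrow>
     degree P = m 1 + m 2 \<and> lead_coeff P = 1 \<and>
     (\<forall>a. \<forall>j < m a.
        (\<lambda>k. pochhammer (- real k) j * poly P (real k) * meixnerI_weight \<beta> c a k) sums 0)"

definition meixnerI_type_II :: "real \<Rightarrow> (2 \<Rightarrow> real) \<Rightarrow> (2 \<Rightarrow> nat) \<Rightarrow> real poly" where
  "meixnerI_type_II \<beta> c m = (THE P. is_meixnerI_type_II \<beta> c m P)"

text \<open>
  The bound \<open>deg (Q a) \<le> n a - 1\<close> is written so that it also forces \<open>Q a = 0\<close> when
  \<open>n a = 0\<close>, and \<open>j \<le> n 1 + n 2 - 2\<close> so as to avoid truncated subtraction.
\<close>

definition is_meixnerI_type_I ::
    "real \<Rightarrow> (2 \<Rightarrow> real) \<Rightarrow> (2 \<Rightarrow> nat) \<Rightarrow> (2 \<Rightarrow> real poly) \<Rightarrow> bool" where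
  "is_meixnerI_type_I \<beta> c n Q \<longleftrightarrow>
     (\<forall>a. Q a = 0 \<or> degree (Q a) + 1 \<le> n a) \<and>
     (\<forall>j. j + 2 \<le> n 1 + n 2 \<longrightarrow>
        (\<lambda>k. real k ^ j * (poly (Q 1) (real k) * meixnerI_weight \<beta> c 1 k
                          + poly (Q 2) (real k) * meixnerI_weight \<beta> c 2 k)) sums 0) \<and>
     (\<forall>m. m 1 + m 2 + 1 = n 1 + n 2 \<longrightarrow>
        (\<lambda>k. poly (meixnerI_type_II \<beta> c m) (real k)
              * (poly (Q 1) (real k) * meixnerI_weight \<beta> c 1 k
               + poly (Q 2) (real k) * meixnerI_weight \<beta> c 2 k)) sums 1)"

definition meixnerI_type_I ::
    "real \<Rightarrow> (2 \<Rightarrow> real) \<Rightarrow> (2 \<Rightarrow> nat) \<Rightarrow> 2 \<Rightarrow> real poly" where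
  "meixnerI_type_I \<beta> c n = (THE Q. is_meixnerI_type_I \<beta> c n Q)"

text \<open>
  In \<open>kampe_de_feriet as bs ds \<alpha>s \<beta>s \<gamma>s x y\<close> the first three lists are the upper
  parameters and the last three the lower ones; within each triple the Pochhammer
  subscripts are \<open>l + m\<close>, \<open>l\<close>, \<open>m\<close>, in this order. If an upper parameter
  and a lower parameter are non-positive integers, the terms in which both Pochhammer
  symbols vanish are \<open>0\<close> by the convention \<open>0 / 0 = 0\<close>: the series is terminated by the
  upper parameter.
\<close>

definition kampe_de_feriet ::
    "real list \<Rightarrow> real list \<Rightarrow> real list \<Rightarrow> real list \<Rightarrow> real list \<Rightarrow> real list \<Rightarrow> real \<Rightarrow> real \<Rightarrow> real" where
  "kampe_de_feriet as bs ds \<alpha>s \<beta>s \<gamma>s x y =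
     (\<Sum>\<^sub>\<infinity>(l, m)\<in>UNIV.
        (\<Prod>a\<leftarrow>as. pochhammer a (l + m)) / (\<Prod>\<alpha>\<leftarrow>\<alpha>s. pochhammer \<alpha> (l + m))
        * ((\<Prod>b\<leftarrow>bs. pochhammer b l) / (\<Prod>\<beta>\<leftarrow>\<beta>s. pochhammer \<beta> l))
        * ((\<Prod>d\<leftarrow>ds. pochhammer d m) / (\<Prod>\<gamma>\<leftarrow>\<gamma>s. pochhammer \<gamma> m))
        * (x ^ l / fact l) * (y ^ m / fact m))"

end

theory Submission
  imports Defs
begin

text \<open>
  Let \<open>L\<^sub>a\<close> be summation against the weight \<open>\<omega>\<^sub>a\<close> and \<open>X\<^sub>a = 1 / (1 - c\<^sub>a)\<close>. By the binomial series,
  \<open>L\<^sub>a((-x)\<^sub>l (\<beta> + x)\<^sub>j)\<close> is \<open>(\<beta>)\<^sub>l\<^sub>+\<^sub>j X\<^sub>a ^ j\<close> up to a nonzero factor depending only on \<open>a\<close> and \<open>l\<close>.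

  Hence for \<open>P = \<Sum>\<^sub>i b\<^sub>i (\<beta> + x)\<^sub>i\<close> the orthogonality conditions of type II say that
  \<open>(z - X\<^sub>a) ^ m\<^sub>a\<close> divides \<open>q(z) = \<Sum>\<^sub>i b\<^sub>i (\<beta>)\<^sub>i z ^ i\<close>, which gives existence and uniqueness of the
  type II polynomials. Pairing a type I solution \<open>Q\<close> of the homogeneous problem with the type II
  polynomial of index \<open>(deg Q\<^sub>1, n\<^sub>2)\<close> (or its mirror image) gives uniqueness for type I.

  For the explicit polynomials, the Chu--Vandermonde identity reduces the pairing with \<open>(\<beta> + x)\<^sub>j\<close>
  to a multiple of the residue of \<open>z ^ j / ((z - X\<^sub>1) ^ n\<^sub>1 (z - X\<^sub>2) ^ n\<^sub>2)\<close> at \<open>X\<^sub>a\<close>; the two residues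
  add up to \<open>0\<close> for \<open>j \<le> n\<^sub>1 + n\<^sub>2 - 2\<close> and to \<open>1\<close> for \<open>j = n\<^sub>1 + n\<^sub>2 - 1\<close>.
\<close>

section \<open>Graded polynomial bases and multiplicities of roots\<close>

lemma poly_pochhammer: "poly (pochhammer p n) x = pochhammer (poly p x) n"
  for p :: "'a::comm_ring_1 poly"
  by (induction n) (simp_all add: pochhammer_Suc)

lemma degree_pochhammer_linear:
  fixes a b :: "'a::idom"
  assumes "b \<noteq> 0"
  shows "degree (pochhammer [:a, b:] n) = n"
    and "lead_coeff (pochhammer [:a, b:] n) = b ^ n"
proof -
  have "degree (pochhammer [:a, b:] n) = n \<and> lead_coeff (pochhammer [:a, b:] n) = b ^ n"
  proof (induction n)
    case (Suc n)
    have lin: "[:a, b:] + of_nat n = [:a + of_nat n, b:]"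
      by (simp add: of_nat_poly)
    have nz: "pochhammer [:a, b:] n \<noteq> 0"
      using Suc assms by (metis leading_coeff_0_iff power_not_zero)
    have "degree (pochhammer [:a, b:] (Suc n)) = Suc n"
      unfolding pochhammer_Suc lin using Suc nz assms
      by (subst degree_mult_eq) auto
    moreover have "lead_coeff (pochhammer [:a, b:] (Suc n)) = b ^ Suc n"
      unfolding pochhammer_Suc lin lead_coeff_mult conjunct2[OF Suc] using assms by simp
    ultimately show ?case by blast
  qed simp
  then show "degree (pochhammer [:a, b:] n) = n"
    and "lead_coeff (pochhammer [:a, b:] n) = b ^ n" by blast+
qed

text \<open>Removing the leading term with a multiple of \<open>B (Suc d)\<close> lowers the degree
  bound by one. The bases used below are rising factorials, falling factorials, and monomials topped
  by a type II polynomial.\<close>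

lemma poly_expand_graded_basis:
  fixes p :: "'a::field poly" and B :: "nat \<Rightarrow> 'a poly"
  assumes B: "\<And>i. degree (B i) = i" "\<And>i. B i \<noteq> 0" and "degree p \<le> d"
  obtains b where "p = (\<Sum>i\<le>d. smult (b i) (B i))"
proof -
  have "\<exists>b. p = (\<Sum>i\<le>d. smult (b i) (B i))" if "degree p \<le> d" for d p
    using that
  proof (induction d arbitrary: p)
    case 0
    obtain s t where st: "p = [:s:]" "B 0 = [:t:]"
      using 0 B(1)[of 0] by (metis degree_eq_zeroE le_zero_eq)
    then have "p = smult (coeff p 0 / coeff (B 0) 0) (B 0)"
      using B(2)[of 0] by simp
    then show ?case by (intro exI[of _ "\<lambda>_. coeff p 0 / coeff (B 0) 0"]) simp
  next
    case (Suc d)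
    define t where "t = coeff p (Suc d) / coeff (B (Suc d)) (Suc d)"
    have nz: "coeff (B (Suc d)) (Suc d) \<noteq> 0"
      using B[of "Suc d"] by (metis leading_coeff_0_iff)
    have "degree (p - smult t (B (Suc d))) \<le> d"
    proof (rule degree_le, intro allI impI)
      fix i assume "d < i"
      then consider "i = Suc d" | "i > Suc d" by linarith
      then show "coeff (p - smult t (B (Suc d))) i = 0"
        using Suc.prems B(1)[of "Suc d"] nz
        by cases (auto simp: t_def coeff_eq_0)
    qed
    from Suc.IH[OF this] obtain b where
      "p - smult t (B (Suc d)) = (\<Sum>i\<le>d. smult (b i) (B i))" by auto
    then have "p = (\<Sum>i\<le>Suc d. smult ((b(Suc d := t)) i) (B i))"
      by (simp add: algebra_simps)
    then show ?case by blast
  qed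
  with assms(3) that show ?thesis by blast
qed

text \<open>The sum on the left is the image of \<open>q\<close> under the product of the operators
  \<open>\<beta> + s + z d/dz\<close>, \<open>s < l\<close>, evaluated at \<open>X\<close>.\<close>

lemma linear_power_dvd_iff_pochhammer_sums:
  fixes q :: "'a::field_char_0 poly"
  assumes "X \<noteq> 0" "degree q \<le> d"
  shows "(\<forall>l<m. (\<Sum>i\<le>d. coeff q i * pochhammer (\<beta> + of_nat i) l * X ^ i) = 0)
           \<longleftrightarrow> [:- X, 1:] ^ m dvd q"
  using assms(2)
proof (induction m arbitrary: q \<beta>)
  case (Suc m)
  let ?T = "smult \<beta> q + pCons 0 (pderiv q)"
  have coeff_T: "coeff ?T i = (\<beta> + of_nat i) * coeff q i" for i
    by (cases i) (simp_all add: coeff_pderiv algebra_simps)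
  have deg_T: "degree ?T \<le> d"
    by (rule degree_le) (use Suc.prems in \<open>auto simp: coeff_T coeff_eq_0 simp del: coeff_add\<close>)
  have root: "(\<Sum>i\<le>d. coeff q i * X ^ i) = poly q X"
    using poly_as_sum_of_monoms'[OF Suc.prems] by (metis (no_types, lifting) poly_monom poly_sum sum.cong)
  \<comment> \<open>The condition l = 0 says that X is a root. In the others,
    \<open>pochhammer (\<beta> + i) (l + 1)\<close> splits off its first factor \<beta> + i, which
    \<open>?T\<close> absorbs, and \<beta> moves to \<beta> + 1.\<close>
  have "(\<forall>l<Suc m. (\<Sum>i\<le>d. coeff q i * pochhammer (\<beta> + of_nat i) l * X ^ i) = 0) \<longleftrightarrow>
      poly q X = 0 \<and>
      (\<forall>l<m. (\<Sum>i\<le>d. coeff ?T i * pochhammer (\<beta> + 1 + of_nat i) l * X ^ i) = 0)"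
    unfolding All_less_Suc2 pochhammer_rec coeff_T
    by (simp add: root algebra_simps)
  also have "\<dots> \<longleftrightarrow> poly q X = 0 \<and> [:- X, 1:] ^ m dvd ?T"
    using Suc.IH[OF deg_T] by blast
  also have "\<dots> \<longleftrightarrow> [:- X, 1:] ^ Suc m dvd q"
  proof (cases "q = 0")
    case False
    define r where "r = order X q"
    show ?thesis
    proof
      assume "[:- X, 1:] ^ Suc m dvd q"
      then obtain s where s: "q = [:- X, 1:] ^ Suc m * s" by (elim dvdE)
      have "[:- X, 1:] ^ m dvd q" "[:- X, 1:] ^ m dvd pderiv q"
        unfolding s lemma_order_pderiv1 using le_imp_power_dvd[of m "Suc m" "[:- X, 1:]"]
        by (auto intro!: dvd_add dvd_smult intro: dvd_mult dvd_mult2 simp del: power_Suc)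
      then have "[:- X, 1:] ^ m dvd smult \<beta> q + [:0, 1:] * pderiv q"
        by (intro dvd_add dvd_smult dvd_mult)
      then show "poly q X = 0 \<and> [:- X, 1:] ^ m dvd ?T"
        by (simp add: s)
    next
      assume h: "poly q X = 0 \<and> [:- X, 1:] ^ m dvd ?T"
      show "[:- X, 1:] ^ Suc m dvd q"
      proof (rule ccontr)
        assume "\<not> ?thesis"
        then have "r \<le> m"
          using False by (simp add: r_def order_divides del: power_Suc)
        from h False have r: "r = Suc (order X (pderiv q))"
          unfolding r_def by (intro order_pderiv) auto
        \<comment> \<open>A nonzero constant has no root.\<close>
        have nz: "pderiv q \<noteq> 0"
          using h False by (metis order_root pderiv_eq_0_iff degree_eq_zeroE poly_pCons
                poly_0 mult_zero_right add_0_right pCons_0_0)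
        \<comment> \<open>As \<open>?T\<close> and \<beta> q are both divisible by (z - X)^r, so is
          z q'. But X is nonzero, so z q' has the order of q' at X, which is only r - 1.\<close>
        have "[:- X, 1:] ^ r dvd ?T"
          using h \<open>r \<le> m\<close> by (meson dvd_trans le_imp_power_dvd)
        moreover have "[:- X, 1:] ^ r dvd smult \<beta> q"
          unfolding r_def by (intro dvd_smult order_1)
        ultimately have "[:- X, 1:] ^ r dvd pCons 0 (pderiv q)"
          by (metis dvd_add_right_iff)
        then have "[:- X, 1:] ^ r dvd [:0, 1:] * pderiv q" by simp
        then have "r \<le> order X ([:0, 1:] * pderiv q)"
          using nz by (subst (asm) order_divides) auto
        also have "\<dots> = order X (pderiv q)"
          using nz assms(1) by (subst order_mult) (auto simp: order_0I)
        finally show False using r by simp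
      qed
    qed
  qed auto
  finally show ?case .
qed auto

section \<open>Residues of a rational function with two poles\<close>

text \<open>The residue of \<open>z ^ j / ((z - X) ^ n1 * (z - Y) ^ n2)\<close> at \<open>X\<close>, read off after substituting
  \<open>z = X + t\<close>.\<close>

definition residue_coeff :: "nat \<Rightarrow> nat \<Rightarrow> 'a::field \<Rightarrow> 'a \<Rightarrow> nat \<Rightarrow> 'a" where
  "residue_coeff n1 n2 X Y j =
     (if n1 = 0 then 0
      else fps_nth ((fps_const X + fps_X) ^ j * inverse (fps_const (X - Y) + fps_X) ^ n2) (n1 - 1))"

lemma residue_coeff_0_left [simp]: "residue_coeff 0 n2 X Y j = 0"
  by (simp add: residue_coeff_def)

text \<open>The extra factor is z = X + t: the summand X keeps the pole order, and t lowers it by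
  one.\<close>

lemma residue_coeff_Suc_exponent:
  "residue_coeff (Suc n1) n2 X Y (Suc j) =
     X * residue_coeff (Suc n1) n2 X Y j + residue_coeff n1 n2 X Y j"
proof -
  let ?G = "(fps_const X + fps_X) ^ j * inverse (fps_const (X - Y) + fps_X) ^ n2"
  have "(fps_const X + fps_X) ^ Suc j * inverse (fps_const (X - Y) + fps_X) ^ n2
          = fps_const X * ?G + fps_X * ?G"
    by (simp add: algebra_simps)
  then show ?thesis
    by (simp add: residue_coeff_def del: power_Suc)
qed

text \<open>Partial fractions: X - Y = (z - Y) - (z - X), and each difference cancels one factor of
  the denominator.\<close>

lemma residue_coeff_lower:
  assumes "X \<noteq> Y"
  shows "(X - Y) * residue_coeff (Suc n1) (Suc n2) X Y j =
     residue_coeff (Suc n1) n2 X Y j - residue_coeff n1 (Suc n2) X Y j"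
proof -
  let ?D = "fps_const (X - Y) + fps_X :: 'a fps"
  let ?A = "(fps_const X + fps_X) ^ j"
  have D: "inverse ?D * ?D = 1"
    using assms by (intro inverse_mult_eq_1) simp
  have "fps_const (X - Y) * (?A * inverse ?D ^ Suc n2)
        = ?A * inverse ?D ^ n2 * (inverse ?D * ?D) - fps_X * (?A * inverse ?D ^ Suc n2)"
    by (simp add: algebra_simps)
  then have "fps_const (X - Y) * (?A * inverse ?D ^ Suc n2)
        = ?A * inverse ?D ^ n2 - fps_X * (?A * inverse ?D ^ Suc n2)"
    by (simp only: D mult_1_right)
  then have "fps_nth (fps_const (X - Y) * (?A * inverse ?D ^ Suc n2)) n1
        = fps_nth (?A * inverse ?D ^ n2) n1 - fps_nth (fps_X * (?A * inverse ?D ^ Suc n2)) n1"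
    by simp
  then show ?thesis
    by (simp add: residue_coeff_def del: power_Suc)
qed

lemma fps_nth_linear_power:
  fixes X :: "'a::comm_ring_1"
  shows "fps_nth ((fps_const X + fps_X) ^ j) p = of_nat (j choose p) * X ^ (j - p)"
proof (induction j arbitrary: p)
  case (Suc j)
  have "(fps_const X + fps_X) ^ Suc j
          = fps_const X * (fps_const X + fps_X) ^ j + fps_X * (fps_const X + fps_X) ^ j"
    by (simp add: algebra_simps)
  then have step: "fps_nth ((fps_const X + fps_X) ^ Suc j) p = X * fps_nth ((fps_const X + fps_X) ^ j) p
       + (if p = 0 then 0 else fps_nth ((fps_const X + fps_X) ^ j) (p - 1))"
    by (simp only: fps_add_nth fps_mult_left_const_nth fps_X_mult_nth)
  show ?case
  proof (cases p)
    case (Suc r)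
    show ?thesis
    proof (cases "Suc r \<le> j")
      case True
      then have "X ^ (j - r) = X * X ^ (j - Suc r)" by (metis Suc_diff_le diff_Suc_Suc power_Suc)
      then show ?thesis unfolding step Suc.IH by (simp add: Suc algebra_simps)
    next
      case False
      then show ?thesis unfolding step Suc.IH by (simp add: Suc binomial_eq_0)
    qed
  qed (use step Suc.IH[of 0] in simp)
qed (auto simp: fps_one_nth binomial_eq_0)

text \<open>This is the negative binomial series. Dividing D = (D + t) - t by a power of D + t gives
  the recurrence \<open>rec\<close>, which the right-hand side satisfies by Pascal's rule.\<close>

lemma fps_nth_inverse_linear_power:
  fixes D :: "'a::field_char_0"
  assumes "D \<noteq> 0"
  shows "fps_nth (inverse (fps_const D + fps_X) ^ Suc n) q
           = (- 1) ^ q * of_nat ((n + q) choose n) / D ^ (Suc n + q)"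
proof -
  let ?I = "inverse (fps_const D + fps_X)"
  have D: "?I * (fps_const D + fps_X) = 1"
    using assms by (intro inverse_mult_eq_1) simp
  have rec: "D * fps_nth (?I ^ Suc n) q = fps_nth (?I ^ n) q -
      (if q = 0 then 0 else fps_nth (?I ^ Suc n) (q - 1))" for n q
  proof -
    have "fps_const D * ?I ^ Suc n = ?I ^ n * (?I * (fps_const D + fps_X)) - fps_X * ?I ^ Suc n"
      by (simp add: algebra_simps)
    then have "fps_const D * ?I ^ Suc n = ?I ^ n - fps_X * ?I ^ Suc n"
      by (simp only: D mult_1_right)
    then have "fps_nth (fps_const D * ?I ^ Suc n) q = fps_nth (?I ^ n - fps_X * ?I ^ Suc n) q"
      by simp
    then show ?thesis by (simp del: power_Suc)
  qed
  show ?thesis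
  \<comment> \<open>The recurrence lowers either the exponent or the coefficient index, so their sum
    is the induction measure.\<close>
  proof (induction "n + q" arbitrary: n q rule: less_induct)
    case less
    show ?case
    proof (cases q)
      case 0
      show ?thesis
      proof (cases n)
        case 0
        then show ?thesis using rec[of 0 0] assms \<open>q = 0\<close> by (simp add: field_simps)
      next
        case (Suc n')
        then show ?thesis using rec[of n 0] less[of n' 0] assms \<open>q = 0\<close>
          by (simp add: field_simps)
      qed
    next
      case (Suc r)
      show ?thesis
      proof (cases n)
        case 0
        have "D * fps_nth (?I ^ Suc 0) q = - ((- 1) ^ r / D ^ Suc r)"
          using rec[of 0 q] less[of 0 r] Suc 0 by (simp del: power_Suc)
        then show ?thesis using assms Suc 0
          by (simp add: field_simps del: power_Suc) (simp add: field_simps)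
      next
        case (Suc n')
        have "D * fps_nth (?I ^ Suc n) q = fps_nth (?I ^ Suc n') q - fps_nth (?I ^ Suc n) r"
          using rec[of n q] \<open>q = Suc r\<close> Suc by (simp del: power_Suc)
        also have "\<dots> = (- 1) ^ q * of_nat ((n' + q) choose n') / D ^ (Suc n' + q)
             - (- 1) ^ r * of_nat ((n + r) choose n) / D ^ (Suc n + r)"
          using less[of n' q] less[of n r] Suc \<open>q = Suc r\<close> by (simp del: power_Suc)
        also have "\<dots> = (- 1) ^ q * of_nat ((n + q) choose n) / D ^ (n + q)"
          using Suc \<open>q = Suc r\<close> assms by (simp add: field_simps)
        finally show ?thesis using assms by (simp add: field_simps)
      qed
    qed
  qed
qed

text \<open>The Cauchy product of the two preceding expansions, in the form to be matched term by
  term with the pairings of the explicit polynomials.\<close>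

lemma residue_coeff_eq_sum:
  fixes X Y :: "'a::field_char_0"
  assumes "X \<noteq> Y"
  shows "residue_coeff (Suc n1) (Suc n2) X Y j =
    (\<Sum>p\<le>n1. of_nat (j choose p) * X ^ (j - p) *
        ((- 1) ^ (n1 - p) * of_nat ((n1 + n2 - p) choose n2) / (X - Y) ^ (n1 + n2 + 1 - p)))"
  unfolding residue_coeff_def fps_mult_nth
  using assms
  by (auto simp: fps_nth_linear_power fps_nth_inverse_linear_power atLeast0AtMost
       simp del: power_Suc intro!: sum.cong)
    (simp add: Suc_diff_le add.commute)

text \<open>The right-hand side is the coefficient of \<open>1/z\<close> in the expansion of
  \<open>z ^ j / ((z - X) ^ n1 * (z - Y) ^ n2)\<close> at infinity.\<close>

lemma residue_coeff_sum:
  fixes X Y :: "'a::field_char_0"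
  assumes "X \<noteq> Y" "j + 1 \<le> n1 + n2"
  shows "residue_coeff n1 n2 X Y j + residue_coeff n2 n1 Y X j
           = (if j + 1 = n1 + n2 then 1 else 0)"
  using assms(2)
proof (induction "n1 + n2" arbitrary: n1 n2 j rule: less_induct)
  case less
  \<comment> \<open>Without a second pole the residue is the coefficient of t^(n-1) in (U + t)^j,
    and j \<le> n - 1 leaves only the leading coefficient.\<close>
  have base: "residue_coeff n 0 U V j = (if j + 1 = n then 1 else 0)" if "j + 1 \<le> n"
    for U V :: 'a and n
    using that by (auto simp: residue_coeff_def fps_nth_linear_power)
  consider "n1 = 0" | "n2 = 0" | r s where "n1 = Suc r" "n2 = Suc s"
    by (metis not0_implies_Suc)
  then show ?case
  proof cases
    case 1
    then show ?thesis using base[of n2 Y X] less.prems by simp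
  next
    case 2
    then show ?thesis using base[of n1 X Y] less.prems by simp
  next
    case 3
    \<comment> \<open>Lowering at both poles produces the residue sums for (n1, s) and (r, n2).
      These have the same total order, so the induction hypothesis gives them equal values and they
      cancel.\<close>
    have low: "residue_coeff n1 n2 X Y i + residue_coeff n2 n1 Y X i = 0" if "i + 2 \<le> n1 + n2" for i
    proof -
      have "(X - Y) * (residue_coeff n1 n2 X Y i + residue_coeff n2 n1 Y X i)
          = (X - Y) * residue_coeff n1 n2 X Y i - (Y - X) * residue_coeff n2 n1 Y X i"
        by (simp add: algebra_simps)
      also have "\<dots> = (residue_coeff n1 s X Y i + residue_coeff s n1 Y X i)
            - (residue_coeff r n2 X Y i + residue_coeff n2 r Y X i)"
        unfolding 3 residue_coeff_lower[OF assms(1)] residue_coeff_lower[OF assms(1)[symmetric]]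
        by simp
      also have "\<dots> = 0"
        using less.hyps[of n1 s i] less.hyps[of r n2 i] 3 that by simp
      finally show ?thesis using assms(1) by simp
    qed
    show ?thesis
    proof (cases "j + 1 = n1 + n2")
      case False
      then show ?thesis using low[of j] less.prems by simp
    next
      case True
      then obtain i where j: "j = Suc i" using 3 by (cases j) auto
      \<comment> \<open>One factor z is split off at both poles. At the second pole Y is written as
        X + (Y - X), and the part with Y - X is handled by
        \<open>residue_coeff_lower\<close>.\<close>
      have "residue_coeff n1 n2 X Y j + residue_coeff n2 n1 Y X j
          = X * (residue_coeff n1 n2 X Y i + residue_coeff n2 n1 Y X i)
            + (residue_coeff r n2 X Y i + residue_coeff n2 r Y X i)"
      proof -
        have "(Y - X) * residue_coeff n2 n1 Y X i
            = residue_coeff n2 r Y X i - residue_coeff s n1 Y X i"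
          unfolding 3 using assms(1) by (intro residue_coeff_lower) auto
        then show ?thesis
          unfolding j 3 residue_coeff_Suc_exponent by (simp add: algebra_simps)
      qed
      also have "\<dots> = 1"
        using low[of i] less.hyps[of r n2 i] 3 j True by simp
      finally show ?thesis using True by simp
    qed
  qed
qed

section \<open>Exchange of the two indices, and divisors with distinct roots\<close>

lemma sum_2_hat: "f 1 + f 2 = f a + f (hat a)" for f :: "2 \<Rightarrow> 'a::ab_semigroup_add"
  using exhaust_2[of a] by (auto simp: hat_def add.commute)

lemma hat_neq [simp]: "hat a \<noteq> a" "a \<noteq> hat a"
  using exhaust_2[of a] by (auto simp: hat_def)

text \<open>The power of z - x contributes nothing to the order at y, so the cofactor
  \<open>s\<close> alone has order at least n there.\<close>

lemma degree_ge_linear_powers_dvd: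
  fixes q :: "'a::idom poly"
  assumes "x \<noteq> y" "q \<noteq> 0" "[:- x, 1:] ^ m dvd q" "[:- y, 1:] ^ n dvd q"
  shows "m + n \<le> degree q"
proof -
  obtain s where s: "q = [:- x, 1:] ^ m * s" using assms(3) by (elim dvdE)
  with assms(2) have "s \<noteq> 0" by auto
  have "order y ([:- x, 1:] ^ m) = 0"
    using assms(1) by (intro order_0I) simp
  then have "order y q = order y s"
    using assms(2) unfolding s by (subst order_mult) auto
  then have "n \<le> order y s"
    using assms(2,4) by (simp add: order_divides)
  also have "\<dots> \<le> degree s" using \<open>s \<noteq> 0\<close> by (rule order_degree)
  finally show ?thesis
    using \<open>s \<noteq> 0\<close> unfolding s by (subst degree_mult_eq) (auto simp: degree_linear_power)
qed

section \<open>Moments of the Meixner weights\<close>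

locale meixnerI =
  fixes \<beta> :: real and c :: "2 \<Rightarrow> real"
  assumes beta_pos: "\<beta> > 0"
    and c_pos: "\<And>a. c a > 0" and c_less_1: "\<And>a. c a < 1"
    and c_neq: "c 1 \<noteq> c 2"
begin

abbreviation falling :: "nat \<Rightarrow> real poly" where
  "falling l \<equiv> pochhammer [:0, - 1:] l"

abbreviation rising :: "nat \<Rightarrow> real poly" where
  "rising j \<equiv> pochhammer [:\<beta>, 1:] j"

definition node :: "2 \<Rightarrow> real" where
  "node a = 1 / (1 - c a)"

definition functional :: "2 \<Rightarrow> real poly \<Rightarrow> real" where
  "functional a p = (\<Sum>k. poly p (real k) * meixnerI_weight \<beta> c a k)"

lemma poch_beta_pos: "pochhammer \<beta> i > 0"
  using beta_pos by (rule pochhammer_pos)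

lemma node_pos: "node a > 0"
  using c_less_1[of a] by (simp add: node_def)

lemma node_neq: "node a \<noteq> node (hat a)"
  using c_neq c_less_1[of 1] c_less_1[of 2] exhaust_2[of a] by (auto simp: node_def hat_def)

lemma weight_eq: "meixnerI_weight \<beta> c a k = pochhammer \<beta> k / fact k * c a ^ k"
proof -
  have "\<beta> \<notin> \<int>\<^sub>\<le>\<^sub>0" using beta_pos by (auto simp: nonpos_Ints_def)
  then show ?thesis
    using Gamma_fact[of k, where 'a = real]
    by (simp add: meixnerI_weight_def pochhammer_Gamma add.commute)
qed

text \<open>The terms with k < l vanish because (-k)_l = 0. After a shift by l the rest is a
  constant times the binomial series of (1 - c_a)^(-(\<beta> + l + j)).\<close>

lemma moment_sums:
  "(\<lambda>k. poly (falling l * rising j) (real k) * meixnerI_weight \<beta> c a k) sums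
     ((1 - c a) powr (- \<beta>) * (- c a * node a) ^ l * node a ^ j * pochhammer \<beta> (l + j))"
    (is "?f sums ?s")
proof -
  have shift: "?f (i + l) = ((- c a) ^ l * pochhammer \<beta> (l + j)) *
      ((- (\<beta> + real (l + j)) gchoose i) * (- c a) ^ i)" for i
  proof -
    have "pochhammer (- real (i + l)) l = (- 1) ^ l * pochhammer (1 + real i) l"
      by (subst pochhammer_minus) (simp add: add.commute)
    moreover have "fact (i + l) = (fact i :: real) * pochhammer (1 + real i) l"
      by (simp add: pochhammer_fact pochhammer_product')
    moreover have "pochhammer (1 + real i) l > 0"
      by (rule pochhammer_pos) simp
    \<comment> \<open>Both sides are \<open>pochhammer \<beta> (i + l + j)\<close>, split at i + l
      and at l + j.\<close>
    moreover have "pochhammer \<beta> (i + l) * pochhammer (\<beta> + real (i + l)) j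
        = pochhammer \<beta> (l + j) * pochhammer (\<beta> + real (l + j)) i"
      using pochhammer_product'[of \<beta> "i + l" j] pochhammer_product'[of \<beta> "l + j" i]
      by (simp add: add_ac)
    moreover have "- real (i + l) = - real i - real l" by simp
    ultimately show ?thesis
      by (simp add: poly_pochhammer weight_eq gbinomial_pochhammer power_add power_minus[of "c a"]
          field_simps)
  qed
  have "(\<lambda>i. (- (\<beta> + real (l + j)) gchoose i) * (- c a) ^ i)
      sums (1 + - c a) powr (- (\<beta> + real (l + j)))"
    using c_pos[of a] c_less_1[of a] by (intro gen_binomial_real) simp
  from sums_mult[OF this, of "(- c a) ^ l * pochhammer \<beta> (l + j)"]
  have "(\<lambda>i. ?f (i + l)) sums
      ((- c a) ^ l * pochhammer \<beta> (l + j) * (1 - c a) powr (- (\<beta> + real (l + j))))"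
    unfolding shift by simp
  moreover have "(1 - c a) powr (- (\<beta> + real (l + j)))
      = (1 - c a) powr (- \<beta>) * node a ^ (l + j)"
  proof -
    have "- (\<beta> + real (l + j)) = - \<beta> + - real (l + j)" by simp
    then show ?thesis
      using c_less_1[of a]
      by (simp only: powr_add powr_minus powr_realpow) (simp add: node_def divide_inverse power_inverse)
  qed
  ultimately have "(\<lambda>i. ?f (i + l)) sums ?s"
    by (simp only: power_add power_mult_distrib mult_ac)
  moreover have "?f k = 0" if "k < l" for k
    using that by (simp add: poly_pochhammer pochhammer_of_nat_eq_0_lemma)
  ultimately show ?thesis
    by (subst (asm) sums_zero_iff_shift) auto
qed

lemma degree_rising [simp]: "degree (rising j) = j"
  and lead_coeff_rising: "coeff (rising j) j = 1"
  using degree_pochhammer_linear[of "1::real" \<beta> j] by auto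

lemma degree_falling [simp]: "degree (falling j) = j"
  using degree_pochhammer_linear(1)[of "-1::real" 0 j] by simp

lemma rising_neq_0: "rising j \<noteq> 0"
  using lead_coeff_rising[of j] by auto

lemma falling_neq_0: "falling j \<noteq> 0"
proof -
  have "lead_coeff (falling j) \<noteq> 0"
    using degree_pochhammer_linear(2)[of "-1::real" 0 j] by simp
  then show ?thesis by (metis leading_coeff_0_iff)
qed

text \<open>Expansion in rising factorials reduces convergence for every polynomial to
  \<open>moment_sums\<close> with l = 0.\<close>

lemma functional_sums:
  "(\<lambda>k. poly p (real k) * meixnerI_weight \<beta> c a k) sums functional a p"
proof -
  define d where "d = degree p"
  obtain b where b: "p = (\<Sum>i\<le>d. smult (b i) (rising i))"
    using poly_expand_graded_basis[of rising p d] rising_neq_0 by (auto simp: d_def)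
  have "summable (\<lambda>k. \<Sum>i\<le>d. b i * (poly (falling 0 * rising i) (real k) * meixnerI_weight \<beta> c a k))"
    by (intro summable_sum summable_mult sums_summable[OF moment_sums])
  also have "(\<lambda>k. \<Sum>i\<le>d. b i * (poly (falling 0 * rising i) (real k) * meixnerI_weight \<beta> c a k))
      = (\<lambda>k. poly p (real k) * meixnerI_weight \<beta> c a k)"
    by (simp add: b poly_sum sum_distrib_left sum_distrib_right mult_ac)
  finally show ?thesis
    unfolding functional_def by (rule summable_sums)
qed

lemma functional_eqI:
  "(\<lambda>k. poly p (real k) * meixnerI_weight \<beta> c a k) sums s \<Longrightarrow> functional a p = s"
  using functional_sums sums_unique2 by blast

lemma functional_add: "functional a (p + q) = functional a p + functional a q"
  using sums_add[OF functional_sums[of p a] functional_sums[of q a]]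
  by (intro functional_eqI) (simp add: algebra_simps)

lemma functional_smult: "functional a (smult t p) = t * functional a p"
  using sums_mult[OF functional_sums[of p a], of t]
  by (intro functional_eqI) (simp add: mult_ac)

lemma functional_0 [simp]: "functional a 0 = 0"
  using functional_smult[of a 0 0] by simp

lemma functional_diff: "functional a (p - q) = functional a p - functional a q"
  using functional_add[of a "p - q" q] by simp

lemma functional_sum: "functional a (\<Sum>i\<in>A. f i) = (\<Sum>i\<in>A. functional a (f i))"
  by (induction A rule: infinite_finite_induct) (simp_all add: functional_add)

lemmas functional_linear = functional_add functional_smult functional_sum

lemma functional_falling_rising:
  "functional a (falling l * rising j)
     = (1 - c a) powr (- \<beta>) * (- c a * node a) ^ l * node a ^ j * pochhammer \<beta> (l + j)"
  by (rule functional_eqI[OF moment_sums])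

section \<open>Existence and uniqueness for type II\<close>

text \<open>Splitting (\<beta>)_(i+l) into (\<beta>)_i and (\<beta> + i)_l turns each pairing, up to
  a nonzero factor, into one of the sums of \<open>linear_power_dvd_iff_pochhammer_sums\<close> for
  \<open>q\<close>.\<close>

lemma functional_falling_eq_0_iff:
  fixes b :: "nat \<Rightarrow> real" and d :: nat
  defines "P \<equiv> (\<Sum>i\<le>d. smult (b i) (rising i))"
    and "q \<equiv> (\<Sum>i\<le>d. monom (b i * pochhammer \<beta> i) i)"
  shows "(\<forall>l<m. functional a (falling l * P) = 0) \<longleftrightarrow> [:- node a, 1:] ^ m dvd q"
proof -
  have coeff_q: "coeff q i = b i * pochhammer \<beta> i" if "i \<le> d" for i
    using that by (simp add: q_def coeff_sum)
  have eq: "functional a (falling l * P) = (1 - c a) powr (- \<beta>) * (- c a * node a) ^ l *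
      (\<Sum>i\<le>d. coeff q i * pochhammer (\<beta> + of_nat i) l * node a ^ i)" for l
    unfolding P_def sum_distrib_left mult_smult_right functional_linear functional_falling_rising
    by (intro sum.cong refl) (simp add: coeff_q add.commute[of l] pochhammer_product' mult_ac)
  have nz: "(1 - c a) powr (- \<beta>) * (- c a * node a) ^ l \<noteq> 0" for l
    using c_pos[of a] c_less_1[of a] node_pos[of a] by simp
  have "functional a (falling l * P) = 0 \<longleftrightarrow>
      (\<Sum>i\<le>d. coeff q i * pochhammer (\<beta> + of_nat i) l * node a ^ i) = 0" for l
    using nz[of l] unfolding eq by (simp only: mult_eq_0_iff simp_thms)
  moreover have "degree q \<le> d"
    unfolding q_def by (intro degree_sum_le) (auto intro: order.trans[OF degree_monom_le])
  ultimately show ?thesis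
    using linear_power_dvd_iff_pochhammer_sums[of "node a" q d m \<beta>] node_pos[of a] by simp
qed

lemma is_meixnerI_type_II_iff:
  "is_meixnerI_type_II \<beta> c m P \<longleftrightarrow> degree P = m 1 + m 2 \<and> lead_coeff P = 1 \<and>
     (\<forall>a. \<forall>j<m a. functional a (falling j * P) = 0)"
proof -
  have "(\<lambda>k. pochhammer (- real k) j * poly P (real k) * meixnerI_weight \<beta> c a k) sums 0
      \<longleftrightarrow> functional a (falling j * P) = 0" for a j
    using functional_sums[of "falling j * P" a] functional_eqI[of "falling j * P" a 0]
    by (auto simp: poly_pochhammer)
  then show ?thesis by (simp add: is_meixnerI_type_II_def)
qed

text \<open>The associated \<open>q\<close> is divisible by linear powers at two distinct nodes
  whose total degree exceeds its own, so it is zero. The coefficients of \<open>P\<close> then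
  vanish because (\<beta>)_i is nonzero.\<close>

lemma orthogonal_degree_less_imp_0:
  assumes orth: "\<And>a l. l < m a \<Longrightarrow> functional a (falling l * P) = 0"
    and deg: "degree P < m 1 + m 2"
  shows "P = 0"
proof -
  define d where "d = m 1 + m 2 - 1"
  have "degree P \<le> d" using deg by (simp add: d_def)
  then obtain b where b: "P = (\<Sum>i\<le>d. smult (b i) (rising i))"
    using poly_expand_graded_basis[of rising P d] rising_neq_0 by auto
  define q where "q = (\<Sum>i\<le>d. monom (b i * pochhammer \<beta> i) i)"
  have "[:- node a, 1:] ^ m a dvd q" for a
    using functional_falling_eq_0_iff[of "m a" a b d] orth[of _ a] unfolding b q_def by blast
  then have "q = 0 \<or> m 1 + m 2 \<le> degree q"
    using node_neq[of 1] degree_ge_linear_powers_dvd[of "node 1" "node 2" q] by (auto simp: hat_def)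
  moreover have "degree q \<le> d"
    unfolding q_def by (intro degree_sum_le) (auto intro: order.trans[OF degree_monom_le])
  ultimately have "q = 0"
    using deg by (auto simp: d_def)
  have "b i = 0" if "i \<le> d" for i
  proof -
    have "coeff q i = b i * pochhammer \<beta> i" using that by (simp add: q_def coeff_sum)
    then show ?thesis using \<open>q = 0\<close> poch_beta_pos[of i] by simp
  qed
  then show ?thesis by (simp add: b)
qed

lemma ex_meixnerI_type_II: "\<exists>P. is_meixnerI_type_II \<beta> c m P"
proof -
  define d where "d = m 1 + m 2"
  define q where "q = [:- node 1, 1:] ^ m 1 * [:- node 2, 1:] ^ m 2"
  \<comment> \<open>The factor (\<beta>)_d makes the leading coefficient \<open>b d\<close> equal to
    1.\<close>
  define b where "b i = coeff q i * pochhammer \<beta> d / pochhammer \<beta> i" for i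
  define P where "P = (\<Sum>i\<le>d. smult (b i) (rising i))"
  have deg_q: "degree q = d"
    by (simp add: q_def d_def degree_mult_eq degree_linear_power)
  have "lead_coeff q = 1"
    unfolding q_def lead_coeff_mult lead_coeff_power by simp
  then have "b d = 1"
    using poch_beta_pos[of d] by (simp add: b_def deg_q)
  have "coeff P d = (\<Sum>i\<le>d. if i = d then b d else 0)"
    unfolding P_def coeff_sum by (intro sum.cong) (auto simp: lead_coeff_rising coeff_eq_0)
  then have "coeff P d = 1" using \<open>b d = 1\<close> by simp
  moreover have "degree P \<le> d"
    unfolding P_def by (intro degree_sum_le) (auto intro: order.trans[OF degree_smult_le])
  ultimately have "degree P = d"
    by (metis le_antisym le_degree zero_neq_one)
  have "(\<Sum>i\<le>d. monom (b i * pochhammer \<beta> i) i) = smult (pochhammer \<beta> d) q"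
  proof -
    have "b i * pochhammer \<beta> i = pochhammer \<beta> d * coeff q i" for i
      using poch_beta_pos[of i] by (simp add: b_def)
    then show ?thesis
      using poly_as_sum_of_monoms[of "smult (pochhammer \<beta> d) q"] poch_beta_pos[of d]
      by (simp add: deg_q)
  qed
  moreover have "[:- node a, 1:] ^ m a dvd q" for a
    using exhaust_2[of a] by (auto simp: q_def)
  ultimately have "\<forall>l<m a. functional a (falling l * P) = 0" for a
    unfolding P_def functional_falling_eq_0_iff by (simp add: dvd_smult)
  then show ?thesis
    using \<open>degree P = d\<close> \<open>coeff P d = 1\<close> by (auto simp: is_meixnerI_type_II_iff d_def)
qed

lemma is_meixnerI_type_II_meixnerI_type_II:
  "is_meixnerI_type_II \<beta> c m (meixnerI_type_II \<beta> c m)"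
proof -
  have "P = P'" if P: "is_meixnerI_type_II \<beta> c m P" and P': "is_meixnerI_type_II \<beta> c m P'" for P P'
  proof -
    have "degree (P - P') \<le> m 1 + m 2" "coeff (P - P') (m 1 + m 2) = 0"
      using P P' unfolding is_meixnerI_type_II_iff by (auto intro: degree_diff_le)
    then have "P - P' = 0 \<or> degree (P - P') < m 1 + m 2"
      by (rule eq_zero_or_degree_less)
    moreover have "functional a (falling l * (P - P')) = 0" if "l < m a" for a l
    proof -
      show ?thesis
        using P P' that by (simp add: right_diff_distrib functional_diff is_meixnerI_type_II_iff)
    qed
    ultimately show ?thesis using orthogonal_degree_less_imp_0[of m "P - P'"] by auto
  qed
  then show ?thesis
    unfolding meixnerI_type_II_def using ex_meixnerI_type_II[of m] by (metis theI)
qed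

section \<open>Characterisation and uniqueness for type I\<close>

lemma functional_orthogonal_degree_less:
  assumes orth: "\<And>l. l < k \<Longrightarrow> functional a (falling l * P) = 0"
    and Q: "Q = 0 \<or> degree Q < k"
  shows "functional a (Q * P) = 0"
proof (cases "Q = 0")
  case False
  define d where "d = degree Q"
  obtain e where "Q = (\<Sum>i\<le>d. smult (e i) (falling i))"
    using poly_expand_graded_basis[of falling Q d] falling_neq_0 by (auto simp: d_def)
  then have "functional a (Q * P) = (\<Sum>i\<le>d. e i * functional a (falling i * P))"
    by (simp add: sum_distrib_right functional_linear)
  also have "\<dots> = 0"
    using Q False orth by (intro sum.neutral) (auto simp: d_def)
  finally show ?thesis .
qed auto

text \<open>The type II polynomial \<open>P\<close> of index \<open>m\<close> annihilates the other
  component and every term of \<open>Q a\<close> below its top one. The vanishing pairing thus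
  supplies the missing orthogonality l = d at a, and \<open>P\<close> satisfies more conditions than
  a nonzero polynomial of its degree can.\<close>

lemma type_I_functional_eq_0_imp_0:
  fixes n :: "2 \<Rightarrow> nat"
  assumes deg: "\<And>a. Q a = 0 \<or> degree (Q a) + 1 \<le> n a"
    and vanish: "\<And>p. degree p < n 1 + n 2 \<Longrightarrow> functional 1 (Q 1 * p) + functional 2 (Q 2 * p) = 0"
  shows "Q a = 0"
proof (rule ccontr)
  assume nz: "Q a \<noteq> 0"
  define d where "d = degree (Q a)"
  define m where "m = n(a := d)"
  define P where "P = meixnerI_type_II \<beta> c m"
  have P: "degree P = d + n (hat a)" "lead_coeff P = 1"
      "\<And>b l. l < m b \<Longrightarrow> functional b (falling l * P) = 0"
    using is_meixnerI_type_II_meixnerI_type_II[of m] sum_2_hat[of m a]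
    unfolding is_meixnerI_type_II_iff P_def by (auto simp: m_def)
  have "degree P < n 1 + n 2"
    using deg[of a] nz sum_2_hat[of n a] by (simp add: P(1) d_def)
  then have "functional a (Q a * P) + functional (hat a) (Q (hat a) * P) = 0"
    using vanish[of P] sum_2_hat[of "\<lambda>b. functional b (Q b * P)" a] by simp
  moreover have "functional (hat a) (Q (hat a) * P) = 0"
  proof (rule functional_orthogonal_degree_less)
    show "functional (hat a) (falling l * P) = 0" if "l < n (hat a)" for l
      using that by (intro P(3)) (simp add: m_def)
    show "Q (hat a) = 0 \<or> degree (Q (hat a)) < n (hat a)"
      using deg[of "hat a"] by (metis Suc_eq_plus1 Suc_le_eq)
  qed
  ultimately have "functional a (Q a * P) = 0" by simp
  obtain e where e: "Q a = (\<Sum>i\<le>d. smult (e i) (falling i))"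
    using poly_expand_graded_basis[of falling "Q a" d] falling_neq_0 by (auto simp: d_def)
  have "e d \<noteq> 0"
  proof
    assume "e d = 0"
    then have "coeff (Q a) d = 0"
      unfolding e coeff_sum by (intro sum.neutral) (auto simp: coeff_eq_0 dest!: le_neq_implies_less)
    then show False using nz by (simp add: d_def)
  qed
  have "functional a (Q a * P) = (\<Sum>i\<le>d. e i * functional a (falling i * P))"
    by (simp add: e sum_distrib_right functional_linear)
  also have "\<dots> = (\<Sum>i\<le>d. if i = d then e d * functional a (falling d * P) else 0)"
    using P(3)[of _ a] by (intro sum.cong) (auto simp: m_def)
  finally have "functional a (falling d * P) = 0"
    using \<open>functional a (Q a * P) = 0\<close> \<open>e d \<noteq> 0\<close> by simp
  then have "functional b (falling l * P) = 0" if "l < (n(a := Suc d)) b" for b l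
    using that P(3)[of l b] by (cases "b = a"; cases "l = d") (auto simp: m_def)
  moreover have "degree P < (n(a := Suc d)) 1 + (n(a := Suc d)) 2"
    unfolding sum_2_hat[of "n(a := Suc d)" a] P(1) by simp
  ultimately have "P = 0" by (rule orthogonal_degree_less_imp_0)
  then show False using P(2) by simp
qed

text \<open>Type II polynomials of total index N are monic of degree N, so both summation conditions
  together say that the pairing extracts the coefficient of degree N. This form is linear in p and
  can be checked on any basis.\<close>

lemma is_meixnerI_type_I_iff:
  assumes "n 1 + n 2 \<ge> 1"
  shows "is_meixnerI_type_I \<beta> c n Q \<longleftrightarrow>
    (\<forall>a. Q a = 0 \<or> degree (Q a) + 1 \<le> n a) \<and>
    (\<forall>p. degree p < n 1 + n 2 \<longrightarrow>
       functional 1 (Q 1 * p) + functional 2 (Q 2 * p) = coeff p (n 1 + n 2 - 1))"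
proof -
  define N where "N = n 1 + n 2 - 1"
  have N: "n 1 + n 2 = Suc N" using assms by (simp add: N_def)
  define F where "F p = functional 1 (Q 1 * p) + functional 2 (Q 2 * p)" for p
  have F_sums: "(\<lambda>k. poly p (real k) * (poly (Q 1) (real k) * meixnerI_weight \<beta> c 1 k
                  + poly (Q 2) (real k) * meixnerI_weight \<beta> c 2 k)) sums F p" for p
    using sums_add[OF functional_sums[of "Q 1 * p" 1] functional_sums[of "Q 2 * p" 2]]
    by (simp add: F_def algebra_simps)
  have F_iff: "(\<lambda>k. poly p (real k) * (poly (Q 1) (real k) * meixnerI_weight \<beta> c 1 k
                  + poly (Q 2) (real k) * meixnerI_weight \<beta> c 2 k)) sums s \<longleftrightarrow> F p = s" for p s
    using F_sums[of p] sums_unique2 by blast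
  have F_monom: "(\<lambda>k. real k ^ j * (poly (Q 1) (real k) * meixnerI_weight \<beta> c 1 k
                  + poly (Q 2) (real k) * meixnerI_weight \<beta> c 2 k)) sums 0 \<longleftrightarrow> F (monom 1 j) = 0" for j
    using F_iff[of "monom 1 j" 0] by (simp add: poly_monom)
  have T: "degree (meixnerI_type_II \<beta> c m) = N" "coeff (meixnerI_type_II \<beta> c m) N = 1"
    if "m 1 + m 2 = N" for m :: "2 \<Rightarrow> nat"
    using is_meixnerI_type_II_meixnerI_type_II[of m] that by (auto simp: is_meixnerI_type_II_def)
  have "(\<forall>j. j < N \<longrightarrow> F (monom 1 j) = 0) \<and>
      (\<forall>m. m 1 + m 2 = N \<longrightarrow> F (meixnerI_type_II \<beta> c m) = 1) \<longleftrightarrow>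
      (\<forall>p. degree p \<le> N \<longrightarrow> F p = coeff p N)" (is "?l \<longleftrightarrow> ?r")
  proof
    assume ?l
    \<comment> \<open>One type II polynomial, here of index (N, 0), completes the monomials of
      degree below N to a graded basis.\<close>
    define m :: "2 \<Rightarrow> nat" where "m = (\<lambda>a. if a = 1 then N else 0)"
    define B where "B i = (if i = N then meixnerI_type_II \<beta> c m else monom 1 i)" for i
    have m: "m 1 + m 2 = N" by (simp add: m_def)
    have B: "degree (B i) = i" "B i \<noteq> 0" for i
      using T[OF m] by (auto simp: B_def degree_monom_eq)
    show ?r
    proof (intro allI impI)
      fix p :: "real poly" assume "degree p \<le> N"
      then obtain b where b: "p = (\<Sum>i\<le>N. smult (b i) (B i))"
        using poly_expand_graded_basis[of B p N] B by blast
      have "F p = (\<Sum>i\<le>N. b i * F (B i))"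
        by (simp add: b F_def sum_distrib_left functional_linear sum.distrib distrib_left)
      also have "\<dots> = (\<Sum>i\<le>N. b i * coeff (B i) N)"
        using \<open>?l\<close> m T(2)[OF m] by (intro sum.cong) (auto simp: B_def)
      also have "\<dots> = coeff p N" by (simp add: b coeff_sum)
      finally show "F p = coeff p N" .
    qed
  next
    assume ?r
    then show ?l
      using T by (auto simp: degree_monom_eq)
  qed
  then show ?thesis
    unfolding is_meixnerI_type_I_def F_monom F_iff N F_def
    by (simp add: less_Suc_eq_le Suc_le_eq)
qed

lemma meixnerI_type_I_eqI:
  assumes "n 1 + n 2 \<ge> 1" and Q: "is_meixnerI_type_I \<beta> c n Q"
  shows "meixnerI_type_I \<beta> c n = Q"
  unfolding meixnerI_type_I_def
proof (rule the_equality[where P = "is_meixnerI_type_I \<beta> c n", OF Q])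
  fix R assume R: "is_meixnerI_type_I \<beta> c n R"
  have deg: "S a = 0 \<or> degree (S a) + 1 \<le> n a"
    and val: "degree p < n 1 + n 2 \<Longrightarrow>
      functional 1 (S 1 * p) + functional 2 (S 2 * p) = coeff p (n 1 + n 2 - 1)"
    if "is_meixnerI_type_I \<beta> c n S" for S a p
    using that unfolding is_meixnerI_type_I_iff[OF assms(1)] by blast+
  have "R a - Q a = 0" for a
  proof (rule type_I_functional_eq_0_imp_0[where Q = "\<lambda>a. R a - Q a" and n = n])
    fix a
    show "R a - Q a = 0 \<or> degree (R a - Q a) + 1 \<le> n a"
      using deg[OF R, of a] deg[OF Q, of a] degree_diff_le_max[of "R a" "Q a"] by auto
  next
    fix p :: "real poly" assume "degree p < n 1 + n 2"
    then show "functional 1 ((R 1 - Q 1) * p) + functional 2 ((R 2 - Q 2) * p) = 0"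
      using val[OF R, of p] val[OF Q, of p] by (simp add: left_diff_distrib functional_diff)
  qed
  then show "R = Q" by (intro ext) simp
qed

end

section \<open>Pochhammer symbols at negative integers and the terminating double series\<close>

lemma pochhammer_minus_nat:
  fixes d p :: nat
  assumes "p \<le> d"
  shows "pochhammer (- real d) p = (- 1) ^ p * fact d / fact (d - p)"
proof -
  have "real (d choose p) = (- 1) ^ p * pochhammer (- real d) p / fact p"
    by (simp add: binomial_gbinomial gbinomial_pochhammer)
  moreover have "real (d choose p) = fact d / (fact p * fact (d - p))"
    using assms by (rule binomial_fact)
  ultimately have "fact d / (fact p * fact (d - p)) = (- 1) ^ p * pochhammer (- real d) p / fact p"
    by simp
  then have "pochhammer (- real d) p * ((- 1) ^ p * (- 1) ^ p) = (- 1) ^ p * fact d / fact (d - p)"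
    by (simp add: field_simps)
  then show ?thesis by (simp flip: power_mult_distrib)
qed

lemma pochhammer_minus_nat_binomial:
  "pochhammer (- real j) p = (- 1) ^ p * fact p * real (j choose p)"
  by (simp add: binomial_gbinomial gbinomial_pochhammer flip: power_mult_distrib)

lemma sum_triangle: "(\<Sum>(l, m)\<in>{(l, m). l + m \<le> d}. f l m) = (\<Sum>l = 0..d. \<Sum>m = 0..d - l. f l m)"
  for f :: "nat \<Rightarrow> nat \<Rightarrow> 'a::comm_monoid_add"
proof -
  have "{(l, m). l + m \<le> d} = Sigma {0..d} (\<lambda>l. {0..d - l})" by auto
  then show ?thesis by (simp add: sum.Sigma)
qed

text \<open>The symbol (-d)_(l+m) is zero for l + m > d, also where the lower symbol vanishes and
  the quotient is 0 / 0 = 0. Only a finite triangle remains.\<close>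

lemma kampe_de_feriet_terminating:
  fixes d e :: nat
  shows "kampe_de_feriet [- real d, b] [y] [] [- real (d + e)] [b] [] u v =
    (\<Sum>l = 0..d. \<Sum>m = 0..d - l.
       pochhammer (- real d) (l + m) * pochhammer b (l + m)
       / (fact l * fact m * pochhammer (- real (d + e)) (l + m) * pochhammer b l)
       * u ^ l * v ^ m * pochhammer y l)"
proof -
  let ?T = "\<lambda>l m. pochhammer (- real d) (l + m) * pochhammer b (l + m)
       / (fact l * fact m * pochhammer (- real (d + e)) (l + m) * pochhammer b l)
       * u ^ l * v ^ m * pochhammer y l"
  have fin: "finite {(l, m). l + m \<le> d}"
    by (rule finite_subset[of _ "{..d} \<times> {..d}"]) auto
  have "kampe_de_feriet [- real d, b] [y] [] [- real (d + e)] [b] [] u v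
      = (\<Sum>\<^sub>\<infinity>(l, m)\<in>{(l, m). l + m \<le> d}. ?T l m)"
    unfolding kampe_de_feriet_def
    by (rule infsum_cong_neutral)
      (auto simp: pochhammer_of_nat_eq_0_lemma not_le mult_ac simp del: of_nat_add)
  also have "\<dots> = (\<Sum>(l, m)\<in>{(l, m). l + m \<le> d}. ?T l m)"
    using fin by simp
  finally show ?thesis by (simp only: sum_triangle)
qed

section \<open>The explicit type I polynomials\<close>

context meixnerI
begin

text \<open>The second argument of the series. By \<open>node_diff\<close> it is the difference of
  the two nodes relative to \<open>node a\<close>.\<close>

definition ratio :: "2 \<Rightarrow> real" where
  "ratio a = (c a - c (hat a)) / (1 - c (hat a))"

text \<open>This is K_a for n_a = d + 1 and the other index equal to e + 1.\<close>

definition explicit_const :: "2 \<Rightarrow> nat \<Rightarrow> nat \<Rightarrow> real" where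
  "explicit_const a d e = (- 1) ^ d * fact (d + e) * (1 - c a) powr (real (d + e + 1) + \<beta>)
     / (fact d * fact e * pochhammer \<beta> (d + e + 1)) * (1 / ratio a) ^ (d + e + 1)"

text \<open>The double sum is grouped by p = l + m, so that for fixed p the sum over l can be
  evaluated by Chu--Vandermonde.\<close>

definition explicit_poly :: "2 \<Rightarrow> nat \<Rightarrow> nat \<Rightarrow> real poly" where
  "explicit_poly a d e = smult (explicit_const a d e) (\<Sum>p\<le>d. \<Sum>l\<le>p.
     smult (pochhammer (- real d) p * pochhammer \<beta> p
              / (fact l * fact (p - l) * pochhammer (- real (d + e)) p * pochhammer \<beta> l)
              * (ratio a * (1 - c a) / c a) ^ l * ratio a ^ (p - l)) (falling l))"

lemma node_diff: "node a - node (hat a) = ratio a * node a"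
  using c_less_1[of a] c_less_1[of "hat a"]
  by (simp add: node_def ratio_def divide_simps)

lemma ratio_neq_0: "ratio a \<noteq> 0"
  using node_diff[of a] node_neq[of a] by auto

text \<open>Since (-1)^l / (p - l)! = (-p)_l / p!, this is Chu--Vandermonde for 2F1(-p, \<beta> + j;
  \<beta>; 1).\<close>

lemma explicit_inner_sum:
  "(\<Sum>l\<le>p. (- 1) ^ l * pochhammer \<beta> (l + j) / (fact l * fact (p - l) * pochhammer \<beta> l))
     = pochhammer \<beta> j * (pochhammer (- real j) p / (fact p * pochhammer \<beta> p))"
proof -
  have "(\<Sum>l\<le>p. (- 1) ^ l * pochhammer \<beta> (l + j) / (fact l * fact (p - l) * pochhammer \<beta> l))
      = (\<Sum>l\<le>p. pochhammer \<beta> j / fact p *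
           (pochhammer (\<beta> + real j) l * pochhammer (- real p) l / (fact l * pochhammer \<beta> l)))"
    by (intro sum.cong refl)
      (simp add: pochhammer_minus_nat add.commute[of _ j] pochhammer_product' mult_ac)
  also have "\<dots> = pochhammer \<beta> j / fact p * (\<Sum>l = 0..p.
      pochhammer (\<beta> + real j) l * pochhammer (- of_nat p) l / (of_nat (fact l) * pochhammer \<beta> l))"
    by (simp add: sum_distrib_left atLeast0AtMost)
  also have "\<dots> = pochhammer \<beta> j / fact p * (pochhammer (\<beta> - (\<beta> + real j)) p / pochhammer \<beta> p)"
    using beta_pos by (subst Vandermonde_pochhammer) auto
  finally show ?thesis by simp
qed

text \<open>Once the sum over l is evaluated, the remaining sum over p agrees termwise with
  \<open>residue_coeff_eq_sum\<close>: \<open>A p\<close> and (-j)_p yield the two binomials, and v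
  X is the difference of the nodes.\<close>

lemma functional_explicit_poly:
  "functional a (explicit_poly a d e * rising j) =
     pochhammer \<beta> j / pochhammer \<beta> (d + e + 1)
       * residue_coeff (Suc d) (Suc e) (node a) (node (hat a)) j"
proof -
  define v where "v = ratio a"
  define X where "X = node a"
  define C where "C = (1 - c a) powr (- \<beta>)"
  define A where "A p = pochhammer (- real d) p / pochhammer (- real (d + e)) p" for p
  have v: "v \<noteq> 0" and X: "X > 0"
    by (simp_all add: v_def X_def ratio_neq_0 node_pos)
  \<comment> \<open>The first argument of the series times \<open>- c a * X\<close> is -v, so l
    survives only in the sign.\<close>
  have cancel: "(v * (1 - c a) / c a) ^ l * v ^ (p - l) * (- c a * X) ^ l = (- 1) ^ l * v ^ p"
    if "l \<le> p" for l p
  proof -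
    have "v * (1 - c a) / c a * (- c a * X) = (- 1) * v"
      using c_pos[of a] c_less_1[of a] by (simp add: X_def node_def)
    then have "(v * (1 - c a) / c a) ^ l * (- c a * X) ^ l = (- 1) ^ l * v ^ l"
      by (metis power_mult_distrib)
    moreover have "v ^ p = v ^ l * v ^ (p - l)"
      using that by (simp flip: power_add)
    ultimately show ?thesis by (simp add: mult_ac)
  qed
  have "functional a (explicit_poly a d e * rising j) = explicit_const a d e * (\<Sum>p\<le>d. \<Sum>l\<le>p.
      pochhammer (- real d) p * pochhammer \<beta> p
        / (fact l * fact (p - l) * pochhammer (- real (d + e)) p * pochhammer \<beta> l)
        * (v * (1 - c a) / c a) ^ l * v ^ (p - l) * (C * (- c a * X) ^ l * X ^ j * pochhammer \<beta> (l + j)))"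
    unfolding explicit_poly_def mult_smult_left sum_distrib_right functional_linear
      functional_falling_rising v_def X_def C_def by simp
  also have "\<dots> = explicit_const a d e * (\<Sum>p\<le>d. C * X ^ j * A p * v ^ p * pochhammer \<beta> p *
      (\<Sum>l\<le>p. (- 1) ^ l * pochhammer \<beta> (l + j) / (fact l * fact (p - l) * pochhammer \<beta> l)))"
  proof -
    have "pochhammer (- real d) p * pochhammer \<beta> p
        / (fact l * fact (p - l) * pochhammer (- real (d + e)) p * pochhammer \<beta> l)
        * (v * (1 - c a) / c a) ^ l * v ^ (p - l) * (C * (- c a * X) ^ l * X ^ j * pochhammer \<beta> (l + j))
      = C * X ^ j * A p * v ^ p * pochhammer \<beta> p *
        ((- 1) ^ l * pochhammer \<beta> (l + j) / (fact l * fact (p - l) * pochhammer \<beta> l))"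
      (is "?lhs = ?rhs") if "l \<le> p" for p l
    proof -
      have "?lhs = A p * pochhammer \<beta> p / (fact l * fact (p - l) * pochhammer \<beta> l)
         * ((v * (1 - c a) / c a) ^ l * v ^ (p - l) * (- c a * X) ^ l) * (C * X ^ j * pochhammer \<beta> (l + j))"
        by (simp add: A_def mult_ac)
      also have "\<dots> = ?rhs"
        unfolding cancel[OF that] by (simp add: mult_ac)
      finally show ?thesis .
    qed
    then show ?thesis
      unfolding sum_distrib_left by (intro sum.cong refl) auto
  qed
  also have "\<dots> = (\<Sum>p\<le>d. explicit_const a d e * C * X ^ j * A p * v ^ p * pochhammer \<beta> j *
      (pochhammer (- real j) p / fact p))"
    unfolding explicit_inner_sum sum_distrib_left
    using poch_beta_pos by (intro sum.cong refl) (simp add: less_imp_neq[THEN not_sym])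
  also have "\<dots> = (\<Sum>p\<le>d. pochhammer \<beta> j / pochhammer \<beta> (d + e + 1) *
      (real (j choose p) * X ^ (j - p) *
        ((- 1) ^ (d - p) * real ((d + e - p) choose e) / (v * X) ^ (d + e + 1 - p))))"
  proof (intro sum.cong refl)
    fix p assume "p \<in> {..d}"
    then have p: "p \<le> d" by simp
    \<comment> \<open>The moment factor \<open>C\<close> cancels the exponent \<beta> in K_a. What
      is left of the power of 1 - c_a joins the power of 1 / v.\<close>
    have const: "explicit_const a d e * C = (- 1) ^ d * fact (d + e)
        / (fact d * fact e * pochhammer \<beta> (d + e + 1)) * (1 / (v * X) ^ (d + e + 1))"
    proof -
      have "(1 - c a) powr (real (d + e + 1) + \<beta>) * C = (1 - c a) powr (real (d + e + 1))"
        unfolding C_def powr_add[symmetric] by simp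
      also have "\<dots> = 1 / X ^ (d + e + 1)"
        using c_less_1[of a] by (subst powr_realpow) (simp_all add: X_def node_def power_one_over)
      finally have "(1 - c a) powr (real (d + e + 1) + \<beta>) * C = 1 / X ^ (d + e + 1)" .
      moreover have "explicit_const a d e * C = (- 1) ^ d * fact (d + e)
        / (fact d * fact e * pochhammer \<beta> (d + e + 1)) * (1 / v) ^ (d + e + 1)
        * ((1 - c a) powr (real (d + e + 1) + \<beta>) * C)"
        unfolding explicit_const_def v_def by (simp only: mult_ac times_divide_eq_left times_divide_eq_right)
      ultimately show ?thesis by (simp only: power_mult_distrib power_one_over) simp
    qed
    have A: "fact (d + e) / (fact d * fact e) * A p = real ((d + e - p) choose e)"
    proof -
      have "real ((d + e - p) choose e) = fact (d + e - p) / (fact e * fact (d - p))"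
        using p by (subst binomial_fact) simp_all
      moreover have "A p = (fact d / fact (d - p)) / (fact (d + e) / fact (d + e - p))"
        using p by (simp add: A_def pochhammer_minus_nat del: of_nat_add)
      ultimately show ?thesis by (simp only:) simp
    qed
    show "explicit_const a d e * C * X ^ j * A p * v ^ p * pochhammer \<beta> j * (pochhammer (- real j) p / fact p)
       = pochhammer \<beta> j / pochhammer \<beta> (d + e + 1) * (real (j choose p) * X ^ (j - p) *
        ((- 1) ^ (d - p) * real ((d + e - p) choose e) / (v * X) ^ (d + e + 1 - p)))"
    \<comment> \<open>For p > j both sides vanish with \<open>j choose p\<close>; the split of
      \<open>X ^ j\<close> is valid only for p \<le> j.\<close>
    proof (cases "p \<le> j")
      case False
      then show ?thesis by (simp add: pochhammer_minus_nat_binomial binomial_eq_0)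
    next
      case True
      have "X ^ j * v ^ p * (1 / (v * X) ^ (d + e + 1)) = X ^ (j - p) / (v * X) ^ (d + e + 1 - p)"
      proof -
        have "X ^ j = X ^ (j - p) * X ^ p" "(v * X) ^ (d + e + 1) = (v * X) ^ (d + e + 1 - p) * (v * X) ^ p"
          using True p by (simp_all flip: power_add)
        moreover have "(v * X) ^ p \<noteq> 0" using v X by simp
        ultimately show ?thesis using v X by (simp add: power_mult_distrib)
      qed
      moreover have "(- 1) ^ d * (- 1) ^ p = ((- 1) ^ (d - p) :: real)"
        using p by (simp add: minus_one_power_iff)
      moreover have "explicit_const a d e * C * X ^ j * A p * v ^ p * pochhammer \<beta> j * (pochhammer (- real j) p / fact p)
        = pochhammer \<beta> j / pochhammer \<beta> (d + e + 1) * (((- 1) ^ d * (- 1) ^ p)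
          * (fact (d + e) / (fact d * fact e) * A p) * (X ^ j * v ^ p * (1 / (v * X) ^ (d + e + 1))) * real (j choose p))"
        unfolding const pochhammer_minus_nat_binomial by (simp add: field_simps)
      ultimately show ?thesis unfolding A by simp
    qed
  qed
  also have "\<dots> = pochhammer \<beta> j / pochhammer \<beta> (d + e + 1)
       * residue_coeff (Suc d) (Suc e) (node a) (node (hat a)) j"
    unfolding residue_coeff_eq_sum[OF node_neq[of a]] node_diff sum_distrib_left v_def X_def by simp
  finally show ?thesis .
qed

lemma poly_explicit_poly:
  "poly (explicit_poly a d e) x = explicit_const a d e *
     (\<Sum>l = 0..d. \<Sum>m = 0..d - l.
       pochhammer (- real d) (l + m) * pochhammer \<beta> (l + m)
       / (fact l * fact m * pochhammer (- real (d + e)) (l + m) * pochhammer \<beta> l)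
       * (ratio a * (1 - c a) / c a) ^ l * ratio a ^ m * pochhammer (- x) l)"
  unfolding sum_triangle[symmetric] sum.triangle_reindex_eq explicit_poly_def
  by (simp add: poly_sum poly_pochhammer)

lemma degree_explicit_poly: "degree (explicit_poly a d e) \<le> d"
  unfolding explicit_poly_def
  by (intro order.trans[OF degree_smult_le] degree_sum_le) (auto intro: order.trans[OF degree_smult_le])

text \<open>By uniqueness only the pairings need checking. On \<open>rising j\<close> they are a
  multiple of the sum of both residues, and the multiplier is 1 at j = d + e + 1.\<close>

lemma meixnerI_type_I_eq_explicit_poly:
  assumes "n 1 \<ge> 1" "n 2 \<ge> 1"
  shows "meixnerI_type_I \<beta> c n = (\<lambda>a. explicit_poly a (n a - 1) (n (hat a) - 1))" (is "_ = ?Q")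
proof (rule meixnerI_type_I_eqI)
  show N1: "1 \<le> n 1 + n 2" using assms by simp
  obtain d e where n: "n 1 = Suc d" "n 2 = Suc e"
    using assms by (metis Suc_le_D One_nat_def)
  have hat: "hat 1 = 2" "hat 2 = 1" by (simp_all add: hat_def)
  have rising: "functional 1 (?Q 1 * rising j) + functional 2 (?Q 2 * rising j)
      = (if j = d + e + 1 then 1 else 0)" if "j \<le> d + e + 1" for j
  proof -
    have "functional 1 (?Q 1 * rising j) + functional 2 (?Q 2 * rising j) =
      pochhammer \<beta> j / pochhammer \<beta> (d + e + 1) *
       (residue_coeff (n 1) (n 2) (node 1) (node 2) j + residue_coeff (n 2) (n 1) (node 2) (node 1) j)"
      using functional_explicit_poly[of 1 d e j] functional_explicit_poly[of 2 e d j]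
      by (simp add: n hat algebra_simps)
    also have "\<dots> = pochhammer \<beta> j / pochhammer \<beta> (d + e + 1) * (if j + 1 = n 1 + n 2 then 1 else 0)"
      using node_neq[of 1] that by (subst residue_coeff_sum) (auto simp: n hat)
    finally show ?thesis
      using poch_beta_pos[of "d + e + 1"] by (auto simp: n)
  qed
  show "is_meixnerI_type_I \<beta> c n ?Q"
    unfolding is_meixnerI_type_I_iff[OF N1]
  proof (intro conjI allI impI)
    fix a
    have "n a \<ge> 1" using assms exhaust_2[of a] by auto
    then show "?Q a = 0 \<or> degree (?Q a) + 1 \<le> n a"
      using degree_explicit_poly[of a "n a - 1" "n (hat a) - 1"] by linarith
  next
    fix p :: "real poly" assume "degree p < n 1 + n 2"
    then have "degree p \<le> d + e + 1" by (simp add: n)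
    then obtain b where b: "p = (\<Sum>i\<le>d + e + 1. smult (b i) (rising i))"
      using poly_expand_graded_basis[of rising p "d + e + 1"] rising_neq_0 by auto
    have "functional 1 (?Q 1 * p) + functional 2 (?Q 2 * p)
        = (\<Sum>i\<le>d + e + 1. b i * (functional 1 (?Q 1 * rising i) + functional 2 (?Q 2 * rising i)))"
      unfolding b sum_distrib_left mult_smult_right functional_linear
      by (simp only: distrib_left sum.distrib)
    also have "\<dots> = (\<Sum>i\<le>d + e + 1. if i = d + e + 1 then b i else 0)"
      using rising by (intro sum.cong) auto
    \<comment> \<open>Each \<open>rising i\<close> is monic of degree i, so only the last one has a
      coefficient at d + e + 1.\<close>
    also have "\<dots> = (\<Sum>i\<le>d + e + 1. b i * coeff (rising i) (d + e + 1))"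
      by (intro sum.cong refl) (auto simp: lead_coeff_rising coeff_eq_0 simp del: add_Suc_right)
    also have "\<dots> = coeff p (n 1 + n 2 - 1)"
      unfolding b coeff_sum coeff_smult by (simp add: n)
    finally show "functional 1 (?Q 1 * p) + functional 2 (?Q 2 * p) = coeff p (n 1 + n 2 - 1)" .
  qed
qed

end

theorem proposition4p1:
  fixes \<beta> :: real and c :: "2 \<Rightarrow> real" and n :: "2 \<Rightarrow> nat" and a :: 2 and x :: real
  assumes "\<beta> > 0"
    and "0 < c 1" and "c 1 < 1" and "0 < c 2" and "c 2 < 1" and "c 1 \<noteq> c 2"
    and "n 1 \<ge> 1" and "n 2 \<ge> 1"
  shows "let K = (- 1) ^ (n a - 1) * fact (n 1 + n 2 - 2)
                   * (1 - c a) powr (real (n 1) + real (n 2) - 1 + \<beta>)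
                   / (fact (n 1 - 1) * fact (n 2 - 1) * pochhammer \<beta> (n 1 + n 2 - 1))
                   * ((1 - c (hat a)) / (c a - c (hat a))) ^ (n 1 + n 2 - 1);
             u = (c a - c (hat a)) * (1 - c a) / (c a * (1 - c (hat a)));
             v = (c a - c (hat a)) / (1 - c (hat a))
         in poly (meixnerI_type_I \<beta> c n a) x
              = K * kampe_de_feriet [- real (n a) + 1, \<beta>] [- x] []
                      [- real (n 1) - real (n 2) + 2] [\<beta>] [] u v
          \<and> poly (meixnerI_type_I \<beta> c n a) x
              = K * (\<Sum>l = 0..n a - 1. \<Sum>m = 0..n a - 1 - l.
                      pochhammer (- real (n a) + 1) (l + m) * pochhammer \<beta> (l + m)
                      / (fact l * fact m * pochhammer (- real (n 1) - real (n 2) + 2) (l + m)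
                         * pochhammer \<beta> l)
                      * u ^ l * v ^ m * pochhammer (- x) l)"
proof -
  interpret meixnerI \<beta> c
  proof
    show "c b > 0" "c b < 1" for b
      using assms(2-5) exhaust_2[of b] by auto
  qed (use assms in auto)
  define d where "d = n a - 1"
  define e where "e = n (hat a) - 1"
  have "n b \<ge> 1" for b using assms(7,8) exhaust_2[of b] by auto
  from this[of a] this[of "hat a"] have na: "n a = Suc d" "n (hat a) = Suc e"
    by (simp_all add: d_def e_def)
  have sum: "n 1 + n 2 = d + e + 2"
    using sum_2_hat[of n a] na by simp
  \<comment> \<open>The index a may be either one, so the two factorials may appear in swapped
    order.\<close>
  have facts: "fact (n 1 - 1) * fact (n 2 - 1) = (fact d * fact e :: real)"
    using exhaust_2[of a] na by (auto simp: hat_def mult.commute)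
  have real_sum: "real (n 1) + real (n 2) = real (d + e) + 2"
    using sum by (metis of_nat_add of_nat_numeral)
  have params: "- real (n a) + 1 = - real d" "- real (n 1) - real (n 2) + 2 = - real (d + e)"
    "n a - 1 = d" "n 1 + n 2 - 1 = d + e + 1" "n 1 + n 2 - 2 = d + e"
    "real (n 1) + real (n 2) - 1 + \<beta> = real (d + e + 1) + \<beta>"
    using real_sum sum by (simp_all add: na)
  have u: "(c a - c (hat a)) * (1 - c a) / (c a * (1 - c (hat a))) = ratio a * (1 - c a) / c a"
    by (simp add: ratio_def)
  have K: "(- 1) ^ d * fact (d + e) * (1 - c a) powr (real (d + e + 1) + \<beta>)
      / (fact d * fact e * pochhammer \<beta> (d + e + 1)) * ((1 - c (hat a)) / (c a - c (hat a))) ^ (d + e + 1)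
      = explicit_const a d e"
    by (simp add: explicit_const_def ratio_def)
  have "meixnerI_type_I \<beta> c n a = explicit_poly a d e"
    using meixnerI_type_I_eq_explicit_poly[of n] assms(7,8) by (simp add: d_def e_def)
  then show ?thesis
    unfolding Let_def params facts u K ratio_def[symmetric] kampe_de_feriet_terminating
    by (simp only: poly_explicit_poly)
qed

end
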